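(* Let $X\subset\mathbb{Z}_{>0}$ be a finite set of positive integers. Then $$\mathsf{M}_0(X)\le 1+\lfloor\log(\|X\|_\infty)\rfloor.$$
   Context: Here $\log$ is the base-two logarithm. Write $X=\{x_1,\ldots,x_t\}$ with $t=|X|\ge 1$, and $\|X\|_\infty=\max_{x\in X}|x|$. The semigroup of $X$ is $\mathrm{Sg}(X)=\{\lambda_1x_1+\cdots+\lambda_tx_t:\lambda_1,\ldots,\lambda_t\in\mathbb{Z}_{\ge0}\}$. For $\boldsymbol{\lambda}\in\mathbb{Z}^t$, $\|\boldsymbol{\lambda}\|_0$ denotes the number of nonzero entries of $\boldsymbol{\lambda}$. For $b\in\mathrm{Sg}(X)$, $\mathsf{m}_0(b)=\min\{\|\boldsymbol{\lambda}\|_0:\boldsymbol{\lambda}\in\mathbb{Z}_{\ge0}^t,\ \lambda_1x_1+\cdots+\lambda_tx_t=b\}$, and $\mathsf{M}_0(X)=\max\{\mathsf{m}_0(b):b\in\mathrm{Sg}(X)\}$. *)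

theory Defs
  imports Complex_Main
begin

text \<open>
  The generators are pairwise distinct, so a coefficient vector is indexed by the elements of
  \<open>X\<close> themselves; it is a function of which only the values on \<open>X\<close> matter.
\<close>

definition lin_comb :: "int set \<Rightarrow> (int \<Rightarrow> nat) \<Rightarrow> int" where
  "lin_comb X c = (\<Sum>x\<in>X. int (c x) * x)"

definition Sg :: "int set \<Rightarrow> int set" where
  "Sg X = {lin_comb X c | c. True}"

definition norm0 :: "int set \<Rightarrow> (int \<Rightarrow> 'a::zero) \<Rightarrow> nat" where
  "norm0 X c = card {x \<in> X. c x \<noteq> 0}"

definition norm_infty :: "int set \<Rightarrow> int" where
  "norm_infty X = Max {\<bar>x\<bar> | x. x \<in> X}"

definition m0 :: "int set \<Rightarrow> int \<Rightarrow> nat" where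
  "m0 X b = Min {norm0 X c | c :: int \<Rightarrow> nat. lin_comb X c = b}"

definition M0 :: "int set \<Rightarrow> nat" where
  "M0 X = Max {m0 X b | b. b \<in> Sg X}"

text \<open>
  \<open>Min\<close> and \<open>Max\<close> are unspecified on infinite or empty sets. For finite \<open>X\<close> the sets used in
  the definitions of \<open>m0\<close> and \<open>M0\<close> are finite and nonempty, so both extrema are attained.
\<close>

lemma norm0_le_card: "finite X \<Longrightarrow> norm0 X c \<le> card X"
  unfolding norm0_def by (rule card_mono) auto

lemma finite_m0_set:
  assumes "finite X"
  shows "finite {norm0 X c | c :: int \<Rightarrow> nat. lin_comb X c = b}"
  by (rule finite_subset[of _ "{..card X}"]) (use assms norm0_le_card in auto)

lemma m0_set_nonempty:
  assumes "b \<in> Sg X"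
  shows "{norm0 X c | c :: int \<Rightarrow> nat. lin_comb X c = b} \<noteq> {}"
  using assms by (auto simp: Sg_def)

lemma m0_attained:
  assumes "finite X" "b \<in> Sg X"
  obtains c :: "int \<Rightarrow> nat" where "lin_comb X c = b" "m0 X b = norm0 X c"
  using Min_in[OF finite_m0_set[OF assms(1)] m0_set_nonempty[OF assms(2)]]
  unfolding m0_def by auto

lemma finite_M0_set:
  assumes "finite X"
  shows "finite {m0 X b | b. b \<in> Sg X}"
proof (rule finite_subset)
  show "{m0 X b | b. b \<in> Sg X} \<subseteq> {..card X}"
    using m0_attained[OF assms] norm0_le_card[OF assms] by (smt (verit) atMost_iff mem_Collect_eq subsetI)
qed simp

lemma M0_set_nonempty: "{m0 X b | b. b \<in> Sg X} \<noteq> {}"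
  by (auto simp: Sg_def)

end

theory Submission
  imports Defs
begin

text \<open>
  In a sparsest representation of \<open>b\<close>, fix one generator \<open>y\<close> of its support \<open>S\<close>. If two subsets
  of \<open>S - {y}\<close> had congruent sums modulo \<open>y\<close>, cancelling their common part would give disjoint
  \<open>A, B\<close> and \<open>k \<ge> 0\<close> with \<open>\<Sum>A = \<Sum>B + k y\<close> and \<open>A \<noteq> {}\<close>. Using this relation to lower the
  coefficients on \<open>A\<close> until one of them vanishes, while only raising the other ones inside \<open>S\<close>,
  would shrink the support. By the pigeonhole principle, \<open>2\<^bsup>card S - 1\<^esup> \<le> y\<close>.
\<close>

lemma m0_le_norm0:
  assumes "finite X" "lin_comb X c = b"
  shows "m0 X b \<le> norm0 X c"
  unfolding m0_def by (rule Min_le[OF finite_m0_set[OF assms(1)]]) (use assms(2) in auto)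

text \<open>Adding a multiple of the relation \<open>d\<close> to \<open>c\<close> keeps the value.
  The multiple is the least coefficient of \<open>c\<close> among the generators where
  \<open>d\<close> is -1, so no coefficient becomes negative and one that attains the minimum drops
  to 0.\<close>

lemma support_reduction:
  fixes c :: "int \<Rightarrow> nat" and d :: "int \<Rightarrow> int"
  assumes fin: "finite X"
    and rel: "(\<Sum>x\<in>X. d x * x) = 0"
    and supp: "\<And>x. x \<in> X \<Longrightarrow> c x = 0 \<Longrightarrow> d x = 0"
    and lower: "\<And>x. x \<in> X \<Longrightarrow> d x \<ge> -1"
    and neg: "z \<in> X" "d z = -1"
  obtains c' :: "int \<Rightarrow> nat" where "lin_comb X c' = lin_comb X c" "norm0 X c' < norm0 X c"
proof -
  define N where "N = {x \<in> X. d x = -1}"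
  have N: "finite N" "N \<noteq> {}" using fin neg by (auto simp: N_def)
  define m where "m = Min (c ` N)"
  have "m \<in> c ` N" unfolding m_def using N by (intro Min_in) auto
  then obtain w where w: "w \<in> N" "c w = m" by auto
  have m_le: "m \<le> c x" if "x \<in> N" for x unfolding m_def using N that by simp
  define c' where "c' x = nat (int (c x) + int m * d x)" for x
  have nonneg: "int (c x) + int m * d x \<ge> 0" if "x \<in> X" for x
  proof (cases "d x = -1")
    case True
    then show ?thesis using m_le[of x] that by (simp add: N_def)
  next
    case False
    then have "d x \<ge> 0" using lower[OF that] by linarith
    then show ?thesis by simp
  qed
  have "lin_comb X c' = (\<Sum>x\<in>X. int (c x) * x + int m * (d x * x))"
    unfolding lin_comb_def using nonneg by (intro sum.cong) (auto simp: c'_def algebra_simps)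
  also have "\<dots> = lin_comb X c"
    using rel by (simp add: lin_comb_def sum.distrib flip: sum_distrib_left)
  finally have same: "lin_comb X c' = lin_comb X c" .
  have wX: "w \<in> X" and dw: "d w = -1" using w by (auto simp: N_def)
  \<comment> \<open>The contrapositive of \<open>supp\<close> puts \<open>w\<close> in the old
    support, so the inclusion of supports is strict.\<close>
  have cw: "c w \<noteq> 0" "c' w = 0" using supp[OF wX] w dw by (auto simp: c'_def)
  have vanish: "c' x = 0" if "x \<in> X" "c x = 0" for x
    using supp[OF that] that by (simp add: c'_def)
  have "c x \<noteq> 0" if "x \<in> X" "c' x \<noteq> 0" for x
    using that(2) by (rule contrapos_nn) (rule vanish[OF that(1)])
  then have "{x \<in> X. c' x \<noteq> 0} \<subseteq> {x \<in> X. c x \<noteq> 0}" by auto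
  moreover have "w \<in> {x \<in> X. c x \<noteq> 0}" "w \<notin> {x \<in> X. c' x \<noteq> 0}" using wX cw by simp_all
  ultimately have "{x \<in> X. c' x \<noteq> 0} \<subset> {x \<in> X. c x \<noteq> 0}" by blast
  moreover have "finite {x \<in> X. c x \<noteq> 0}" using fin by simp
  ultimately have "norm0 X c' < norm0 X c" unfolding norm0_def by (rule psubset_card_mono[rotated])
  with same show ?thesis by (rule that)
qed

text \<open>Pigeonhole: the \<open>2 ^ card T\<close> subset sums fall into only \<open>y\<close>
  residue classes modulo \<open>y\<close>.\<close>

lemma subset_sum_collision:
  fixes T :: "int set" and y :: int
  assumes fin: "finite T" and pos: "\<And>x. x \<in> T \<Longrightarrow> x > 0" and "y > 0" and large: "y < 2 ^ card T"
  obtains A B k where "A \<subseteq> T" "B \<subseteq> T" "A \<inter> B = {}" "A \<noteq> {}" "k \<ge> 0" "\<Sum>A = \<Sum>B + k * y"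
proof -
  have "\<not> inj_on (\<lambda>A. \<Sum>A mod y) (Pow T)"
  proof
    assume "inj_on (\<lambda>A. \<Sum>A mod y) (Pow T)"
    then have "card (Pow T) \<le> card {0..<y}"
      using \<open>y > 0\<close> by (intro card_inj_on_le[where f = "\<lambda>A. \<Sum>A mod y"]) auto
    then have "2 ^ card T \<le> nat y" using fin by (simp add: card_Pow)
    then have "int (2 ^ card T) \<le> y" using \<open>y > 0\<close> by linarith
    then show False using large by simp
  qed
  then obtain A B where AB: "A \<subseteq> T" "B \<subseteq> T" "A \<noteq> B" "\<Sum>A mod y = \<Sum>B mod y"
    by (auto simp: inj_on_def)
  \<comment> \<open>The collision is symmetric; naming the set of larger sum \<open>A\<close> makes
    the quotient \<open>k\<close> nonnegative.\<close>
  have "\<exists>A B. A \<subseteq> T \<and> B \<subseteq> T \<and> A \<noteq> B \<and> \<Sum>A mod y = \<Sum>B mod y \<and> \<Sum>B \<le> \<Sum>A"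
    using AB by (metis linorder_le_cases)
  then obtain A B where AB: "A \<subseteq> T" "B \<subseteq> T" "A \<noteq> B" "\<Sum>A mod y = \<Sum>B mod y" "\<Sum>B \<le> \<Sum>A"
    by blast
  have finAB: "finite A" "finite B" using AB fin finite_subset by auto
  have "\<Sum>A = \<Sum>(A - B) + \<Sum>(A \<inter> B)"
    using sum.Int_Diff[OF finAB(1), of "\<lambda>x. x" B] by simp
  moreover have "\<Sum>B = \<Sum>(B - A) + \<Sum>(A \<inter> B)"
    using sum.Int_Diff[OF finAB(2), of "\<lambda>x. x" A] by (simp add: Int_commute)
  ultimately have diff: "\<Sum>A - \<Sum>B = \<Sum>(A - B) - \<Sum>(B - A)" by simp
  obtain k where k: "\<Sum>A - \<Sum>B = y * k" using AB(4) by (metis mod_eq_dvd_iff dvdE)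
  show ?thesis
  proof (rule that)
    show "A - B \<subseteq> T" "B - A \<subseteq> T" "(A - B) \<inter> (B - A) = {}" using AB by auto
    show "k \<ge> 0" using k AB(5) \<open>y > 0\<close> by (smt (verit) mult_pos_neg)
    show "\<Sum>(A - B) = \<Sum>(B - A) + k * y" using diff k by (simp add: algebra_simps)
    \<comment> \<open>Otherwise \<open>B\<close> would properly contain \<open>A\<close> and, its
      elements being positive, have the larger sum.\<close>
    show "A - B \<noteq> {}"
    proof
      assume empty: "A - B = {}"
      then have "B - A \<noteq> {}" using AB(3) by blast
      then have "\<Sum>(B - A) > 0" using finAB pos AB(2) by (intro sum_pos) auto
      then show False using diff AB(5) empty by simp
    qed
  qed
qed

text \<open>The exponent loses 1 because \<open>y\<close> serves as the modulus and only the rest of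
  the support enters the collision.\<close>

lemma minimal_support_bound:
  fixes c :: "int \<Rightarrow> nat"
  assumes fin: "finite X" and pos: "\<And>x. x \<in> X \<Longrightarrow> x > 0"
    and minimal: "m0 X (lin_comb X c) = norm0 X c"
    and y: "y \<in> X" "c y \<noteq> 0"
  shows "2 ^ (norm0 X c - 1) \<le> y"
proof (rule ccontr)
  assume "\<not> 2 ^ (norm0 X c - 1) \<le> y"
  define T where "T = {x \<in> X. c x \<noteq> 0} - {y}"
  have T: "finite T" "T \<subseteq> X" "y \<notin> T" using fin by (auto simp: T_def)
  have "card T = norm0 X c - 1" unfolding T_def norm0_def using y fin by simp
  then have large: "y < 2 ^ card T" using \<open>\<not> 2 ^ (norm0 X c - 1) \<le> y\<close> by simp
  have "y > 0" using pos y by blast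
  have "x > 0" if "x \<in> T" for x using that T(2) pos by blast
  then obtain A B k where AB: "A \<subseteq> T" "B \<subseteq> T" "A \<inter> B = {}" "A \<noteq> {}" "k \<ge> 0"
    and sums: "\<Sum>A = \<Sum>B + k * y"
    using subset_sum_collision[OF T(1) _ \<open>y > 0\<close> large] by blast
  \<comment> \<open>The collision, read as a relation with all terms on one side. Since
    \<open>k\<close> is nonnegative, only elements of \<open>A\<close> can get a negative
    coefficient.\<close>
  define d :: "int \<Rightarrow> int" where
    "d x = of_bool (x \<in> B) - of_bool (x \<in> A) + k * of_bool (x = y)" for x
  have of_bool_sum: "(\<Sum>x\<in>X. of_bool (x \<in> C) * x) = \<Sum>C" if "C \<subseteq> X" for C
    using that fin by (intro sum.mono_neutral_cong_right) auto
  have "(\<Sum>x\<in>X. d x * x) = (\<Sum>x\<in>X. of_bool (x \<in> B) * x) - (\<Sum>x\<in>X. of_bool (x \<in> A) * x)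
      + k * (\<Sum>x\<in>X. of_bool (x \<in> {y}) * x)"
    by (simp add: d_def algebra_simps sum.distrib sum_subtractf sum_distrib_left)
  also have "\<dots> = \<Sum>B - \<Sum>A + k * \<Sum>{y}"
    using AB T y by (simp only: of_bool_sum subset_trans[OF _ T(2)] empty_subsetI insert_subset simp_thms)
  also have "\<dots> = 0" using sums by simp
  finally have rel: "(\<Sum>x\<in>X. d x * x) = 0" .
  obtain z where z: "z \<in> A" using AB by blast
  have "d z = -1" using z AB T by (auto simp: d_def)
  moreover have "d x = 0" if "x \<in> X" "c x = 0" for x
    using that AB y by (auto simp: d_def T_def)
  moreover have "d x \<ge> -1" for x using AB by (auto simp: d_def)
  moreover have "z \<in> X" using z AB T by blast
  ultimately obtain c' :: "int \<Rightarrow> nat"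
    where "lin_comb X c' = lin_comb X c" "norm0 X c' < norm0 X c"
    using support_reduction[OF fin rel, of c z] by blast
  then show False using m0_le_norm0[OF fin, of c' "lin_comb X c"] minimal by simp
qed

theorem theorem2:
  fixes X :: "int set"
  assumes "finite X" and "X \<noteq> {}" and "\<forall>x\<in>X. x > 0"
  shows "int (M0 X) \<le> 1 + \<lfloor>log 2 (real_of_int (norm_infty X))\<rfloor>"
proof -
  have norm: "x \<le> norm_infty X" if "x \<in> X" for x
  proof -
    have "\<bar>x\<bar> \<le> norm_infty X" unfolding norm_infty_def using assms(1) that by (intro Max_ge) auto
    then show ?thesis by simp
  qed
  have norm_pos: "norm_infty X \<ge> 1" 
  proof -
    obtain x where "x \<in> X" using assms(2) by blast
    then show ?thesis using norm[of x] assms(3) by force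
  qed
  have "M0 X \<in> {m0 X b | b. b \<in> Sg X}"
    unfolding M0_def by (rule Max_in[OF finite_M0_set[OF assms(1)] M0_set_nonempty])
  then obtain b where b: "b \<in> Sg X" "M0 X = m0 X b" by auto
  obtain c :: "int \<Rightarrow> nat" where c: "lin_comb X c = b" "m0 X b = norm0 X c"
    using m0_attained[OF assms(1) b(1)] .
  have "2 ^ (norm0 X c - 1) \<le> norm_infty X"
  proof (cases "\<exists>y\<in>X. c y \<noteq> 0")
    case True
    then obtain y where "y \<in> X" "c y \<noteq> 0" by blast
    then show ?thesis
      using minimal_support_bound[of X c y] norm[of y] assms c by (simp add: order_trans)
  next
    case False
    \<comment> \<open>Empty support: truncated subtraction makes the exponent 0, so the bound only
      asks for \<open>norm_infty X\<close> to be at least 1.\<close>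
    then have "{x \<in> X. c x \<noteq> 0} = {}" by blast
    then have "norm0 X c = 0" unfolding norm0_def by (simp only: card.empty)
    then show ?thesis using norm_pos by simp
  qed
  then have "real_of_int (2 ^ (norm0 X c - 1)) \<le> real_of_int (norm_infty X)" by (simp only: of_int_le_iff)
  then have "real (norm0 X c - 1) \<le> log 2 (real_of_int (norm_infty X))"
    using norm_pos by (intro le_log_of_power) auto
  then have "int (norm0 X c - 1) \<le> \<lfloor>log 2 (real_of_int (norm_infty X))\<rfloor>"
    by (simp add: le_floor_iff)
  \<comment> \<open>Truncation is harmless here: \<open>n \<le> 1 + (n - 1)\<close> holds for every
    natural \<open>n\<close>, including 0.\<close>
  then show ?thesis using b c by linarith
qed

end
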